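(* Let $K_1,\ldots,K_m$ be consistent propositional formulae having fewer than four maxsets. Then every consistent or-of-maxsets of $K_1,\ldots,K_m$ is obtainable by priority base merging from $K_1,\ldots,K_m$.
   Context: A maxset of $K_1,\ldots,K_m$ is a maximal (under inclusion) consistent subset $M\subseteq\{K_1,\ldots,K_m\}$; in a disjunction, a maxset stands for the conjunction of its formulae. An or-of-maxsets is a formula equivalent to the disjunction of some set of maxsets of $K_1,\ldots,K_m$. A priority ordering is an ordered partition $P(1),P(2),\ldots,P(k)$ of $\{K_1,\ldots,K_m\}$ into nonempty classes. For $L,N\subseteq\{K_1,\ldots,K_m\}$, $L<N$ iff there is $i$ such that $P(j)\cap L=P(j)\cap N$ for all $j<i$ and $P(i)\cap L\supsetneq P(i)\cap N$. The result of (priority base) merging with $P$ is the disjunction of all maxsets $M$ that are minimal, i.e. such that no maxset $N$ satisfies $N<M$. $R$ is obtainable from $K_1,\ldots,K_m$ if it is equivalent to the result of merging with some priority ordering. *)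

theory Defs
  imports Main "HOL-Library.Disjoint_Sets"
begin

datatype 'a form =
    Atom 'a
  | Bot
  | Neg "'a form"
  | And "'a form" "'a form"
  | Or "'a form" "'a form"
  | Imp "'a form" "'a form"

abbreviation Top :: "'a form" where
  "Top \<equiv> Neg Bot"

primrec holds :: "('a \<Rightarrow> bool) \<Rightarrow> 'a form \<Rightarrow> bool" where
  "holds v (Atom a) \<longleftrightarrow> v a"
| "holds v Bot \<longleftrightarrow> False"
| "holds v (Neg F) \<longleftrightarrow> \<not> holds v F"
| "holds v (And F G) \<longleftrightarrow> holds v F \<and> holds v G"
| "holds v (Or F G) \<longleftrightarrow> holds v F \<or> holds v G"
| "holds v (Imp F G) \<longleftrightarrow> (holds v F \<longrightarrow> holds v G)"

definition consistent :: "'a form \<Rightarrow> bool" where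
  "consistent F \<longleftrightarrow> (\<exists>v. holds v F)"

definition consistent_set :: "'a form set \<Rightarrow> bool" where
  "consistent_set S \<longleftrightarrow> (\<exists>v. \<forall>F\<in>S. holds v F)"

definition equivalent :: "'a form \<Rightarrow> 'a form \<Rightarrow> bool" where
  "equivalent F G \<longleftrightarrow> (\<forall>v. holds v F \<longleftrightarrow> holds v G)"

(* Conjunction and disjunction of a finite set of formulae; the enumeration chosen only
   matters up to equivalence (see holds_Conj and holds_Disj). Meaningless on infinite sets. *)

definition Conj :: "'a form set \<Rightarrow> 'a form" where
  "Conj S = foldr And (SOME xs. set xs = S) Top"

definition Disj :: "'a form set \<Rightarrow> 'a form" where
  "Disj S = foldr Or (SOME xs. set xs = S) Bot"

lemma holds_foldr_And: "holds v (foldr And xs Top) \<longleftrightarrow> (\<forall>F\<in>set xs. holds v F)"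
  by (induction xs) auto

lemma holds_foldr_Or: "holds v (foldr Or xs Bot) \<longleftrightarrow> (\<exists>F\<in>set xs. holds v F)"
  by (induction xs) auto

lemma holds_Conj:
  assumes "finite S"
  shows "holds v (Conj S) \<longleftrightarrow> (\<forall>F\<in>S. holds v F)"
  unfolding Conj_def holds_foldr_And
  using someI_ex[OF finite_list[OF assms]] by simp

lemma holds_Disj:
  assumes "finite S"
  shows "holds v (Disj S) \<longleftrightarrow> (\<exists>F\<in>S. holds v F)"
  unfolding Disj_def holds_foldr_Or
  using someI_ex[OF finite_list[OF assms]] by simp

definition maxset :: "'a form set \<Rightarrow> 'a form set \<Rightarrow> bool" where
  "maxset K M \<longleftrightarrow> M \<subseteq> K \<and> consistent_set M \<and>
     (\<forall>N. N \<subseteq> K \<and> consistent_set N \<and> M \<subseteq> N \<longrightarrow> N = M)"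

definition maxsets :: "'a form set \<Rightarrow> 'a form set set" where
  "maxsets K = {M. maxset K M}"

definition or_of_maxsets :: "'a form set \<Rightarrow> 'a form \<Rightarrow> bool" where
  "or_of_maxsets K R \<longleftrightarrow> (\<exists>\<M> \<subseteq> maxsets K. equivalent R (Disj (Conj ` \<M>)))"

(* The class P(i) is the list element P ! (i - 1). *)

definition priority_ordering :: "'a form set \<Rightarrow> 'a form set list \<Rightarrow> bool" where
  "priority_ordering K P \<longleftrightarrow> partition_on K (set P) \<and> distinct P"

definition priority_less :: "'a form set list \<Rightarrow> 'a form set \<Rightarrow> 'a form set \<Rightarrow> bool" where
  "priority_less P L N \<longleftrightarrow>
     (\<exists>i < length P. (\<forall>j < i. P ! j \<inter> L = P ! j \<inter> N) \<and> P ! i \<inter> L \<supset> P ! i \<inter> N)"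

definition minimal_maxsets :: "'a form set \<Rightarrow> 'a form set list \<Rightarrow> 'a form set set" where
  "minimal_maxsets K P = {M \<in> maxsets K. \<not> (\<exists>N \<in> maxsets K. priority_less P N M)}"

definition merge :: "'a form set \<Rightarrow> 'a form set list \<Rightarrow> 'a form" where
  "merge K P = Disj (Conj ` minimal_maxsets K P)"

definition obtainable :: "'a form set \<Rightarrow> 'a form \<Rightarrow> bool" where
  "obtainable K R \<longleftrightarrow> (\<exists>P. priority_ordering K P \<and> equivalent R (merge K P))"

end

theory Submission imports Defs begin

text \<open>
  Maxsets form an antichain, so under the ordering \<open>Q, K - Q\<close> only strict inclusion between
  intersections with \<open>Q\<close> matters. All maxsets survive for \<open>Q = K\<close>, and a single maxset \<open>M\<close>
  survives for \<open>Q = M\<close>. To discard \<open>C\<close> out of three maxsets \<open>A, B, C\<close>, take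
  \<open>Q = (A \<inter> B) - C\<close> if this is nonempty: both \<open>A\<close> and \<open>B\<close> contain it. Otherwise
  take \<open>Q = (A \<union> B) - C\<close>: then \<open>A \<inter> Q\<close> and \<open>B \<inter> Q\<close> are disjoint and nonempty.
\<close>

lemma maxset_antichain:
  assumes "M \<in> maxsets K" "N \<in> maxsets K" "M \<subseteq> N"
  shows "M = N"
  using assms by (auto simp: maxsets_def maxset_def)

text \<open>This removes priority orderings from the problem: what remains is to find a suitable
  \<open>Q\<close>.\<close>

lemma ex_priority_ordering_minimal_maxsets:
  assumes "Q \<subseteq> K"
  shows "\<exists>P. priority_ordering K P \<and>
    minimal_maxsets K P = {M \<in> maxsets K. \<forall>N \<in> maxsets K. \<not> Q \<inter> M \<subset> Q \<inter> N}"
proof -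
  have sub: "M \<subseteq> K" if "M \<in> maxsets K" for M
    using that by (auto simp: maxsets_def maxset_def)
  \<comment> \<open>Classes must be nonempty, so \<open>[Q, K - Q]\<close> is an ordering only for
    nonempty proper \<open>Q\<close>. Otherwise \<open>[]\<close> or \<open>[K]\<close> serves, and
    every maxset is minimal.\<close>
  consider "K = {}" | "K \<noteq> {}" "Q = {} \<or> Q = K" | "Q \<noteq> {}" "Q \<noteq> K"
    by blast
  then show ?thesis
  proof cases
    case 1
    then have "priority_ordering K []"
      by (simp add: priority_ordering_def partition_on_def)
    moreover have "minimal_maxsets K [] = {M \<in> maxsets K. \<forall>N \<in> maxsets K. \<not> Q \<inter> M \<subset> Q \<inter> N}"
      using 1 assms by (auto simp: minimal_maxsets_def priority_less_def)
    ultimately show ?thesis by blast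
  next
    case 2
    then have "priority_ordering K [K]"
      by (auto simp: priority_ordering_def partition_on_def)
    moreover have "\<not> K \<inter> M \<subset> K \<inter> N" if "M \<in> maxsets K" "N \<in> maxsets K" for M N
      using maxset_antichain[OF that] sub[OF that(1)] sub[OF that(2)] by blast
    then have "minimal_maxsets K [K] = {M \<in> maxsets K. \<forall>N \<in> maxsets K. \<not> Q \<inter> M \<subset> Q \<inter> N}"
      using 2 by (auto simp: minimal_maxsets_def priority_less_def)
    ultimately show ?thesis by blast
  next
    case 3
    have "priority_ordering K [Q, K - Q]"
      using 3 assms by (auto simp: priority_ordering_def partition_on_def disjoint_def)
    moreover have "priority_less [Q, K - Q] N M \<longleftrightarrow> Q \<inter> M \<subset> Q \<inter> N"
      if "M \<in> maxsets K" "N \<in> maxsets K" for M N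
    proof -
      have "priority_less [Q, K - Q] N M \<longleftrightarrow>
          Q \<inter> M \<subset> Q \<inter> N \<or> Q \<inter> N = Q \<inter> M \<and> (K - Q) \<inter> M \<subset> (K - Q) \<inter> N"
        by (simp add: priority_less_def Ex_less_Suc All_less_Suc disj_commute)
      \<comment> \<open>A tie on \<open>Q\<close> with strict inclusion on \<open>K - Q\<close>
        would give \<open>M \<subset> N\<close>.\<close>
      moreover have "\<not> (Q \<inter> M = Q \<inter> N \<and> (K - Q) \<inter> M \<subset> (K - Q) \<inter> N)"
        using maxset_antichain[OF that] sub[OF that(1)] sub[OF that(2)] by blast
      ultimately show ?thesis by blast
    qed
    then have "minimal_maxsets K [Q, K - Q] =
        {M \<in> maxsets K. \<forall>N \<in> maxsets K. \<not> Q \<inter> M \<subset> Q \<inter> N}"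
      by (auto simp: minimal_maxsets_def)
    ultimately show ?thesis by blast
  qed
qed

text \<open>With at most three maxsets, a nonempty \<open>\<M>\<close> consists of all of them, of
  one, or of two out of three; each shape has its own \<open>Q\<close>.\<close>

lemma ex_separating_subset:
  assumes "finite K" "card (maxsets K) < 4" "\<M> \<subseteq> maxsets K" "\<M> \<noteq> {}"
  shows "\<exists>Q \<subseteq> K. {M \<in> maxsets K. \<forall>N \<in> maxsets K. \<not> Q \<inter> M \<subset> Q \<inter> N} = \<M>"
proof -
  have sub: "M \<subseteq> K" if "M \<in> maxsets K" for M
    using that by (auto simp: maxsets_def maxset_def)
  then have fin: "finite (maxsets K)"
    using assms(1) by (intro finite_subset[of "maxsets K" "Pow K"]) auto
  then have fin': "finite \<M>"
    using assms(3) finite_subset by blast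
  consider "\<M> = maxsets K" | "card \<M> = 1" | "\<M> \<noteq> maxsets K" "card \<M> \<ge> 2"
  proof -
    have "card \<M> \<noteq> 0"
      using assms(4) fin' by simp
    then show thesis
      using that by linarith
  qed
  then show ?thesis
  proof cases
    case 1
    have "\<not> K \<inter> M \<subset> K \<inter> N" if "M \<in> maxsets K" "N \<in> maxsets K" for M N
      using maxset_antichain[OF that] sub[OF that(1)] sub[OF that(2)] by blast
    with 1 show ?thesis by blast
  next
    case 2
    then obtain M where M: "\<M> = {M}"
      by (auto simp: card_1_singleton_iff)
    then have "M \<in> maxsets K" using assms(3) by blast
    \<comment> \<open>For \<open>Q = M\<close>, any other maxset \<open>L\<close> loses to
      \<open>M\<close> itself: \<open>M \<inter> L \<subset> M\<close> since \<open>M\<close> is not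
      contained in \<open>L\<close>.\<close>
    then have "{L \<in> maxsets K. \<forall>N \<in> maxsets K. \<not> M \<inter> L \<subset> M \<inter> N} = \<M>"
      using M maxset_antichain[of M K] by blast
    with \<open>M \<in> maxsets K\<close> sub show ?thesis by blast
  next
    case 3
    then have "card \<M> < card (maxsets K)"
      using assms(3) fin by (simp add: psubset_card_mono psubsetI)
    \<comment> \<open>The bound enters here: 2 \<le> \<open>card \<M>\<close> <
      \<open>card (maxsets K)\<close> < 4.\<close>
    then have "card \<M> = 2" "card (maxsets K - \<M>) = 1"
      using 3 assms(2,3) fin' by (auto simp: card_Diff_subset)
    then obtain A B C where AB: "\<M> = {A, B}" "A \<noteq> B" and "maxsets K - \<M> = {C}"
      by (auto simp: card_2_iff card_1_singleton_iff)
    then have K: "maxsets K = {A, B, C}" and C: "C \<noteq> A" "C \<noteq> B"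
      using assms(3) by blast+
    have anti: "\<not> X \<subseteq> Y" if "X \<in> {A, B, C}" "Y \<in> {A, B, C}" "X \<noteq> Y" for X Y
      using maxset_antichain[of X K Y] that K by auto
    have AC: "A - C \<noteq> {}" and BC: "B - C \<noteq> {}"
      using anti[of A C] anti[of B C] C by auto
    define Q where "Q = (if A \<inter> B - C = {} then A \<union> B - C else A \<inter> B - C)"
    have "Q \<subseteq> K"
      using sub[of A] sub[of B] K by (auto simp: Q_def)
    have QC: "Q \<inter> C = {}"
      by (auto simp: Q_def)
    \<comment> \<open>Either \<open>Q\<close> lies in both \<open>A\<close> and \<open>B\<close>, or
      its traces on them are \<open>A - C\<close> and \<open>B - C\<close>, which are nonempty and
      disjoint, hence incomparable.\<close>
    have QAB: "Q \<inter> A \<noteq> {}" "\<not> Q \<inter> A \<subset> Q \<inter> B" "\<not> Q \<inter> B \<subset> Q \<inter> A"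
      using AC BC by (auto simp: Q_def split: if_splits)
    have "\<forall>N \<in> {A, B, C}. \<not> Q \<inter> A \<subset> Q \<inter> N" "\<forall>N \<in> {A, B, C}. \<not> Q \<inter> B \<subset> Q \<inter> N"
      using QC QAB by simp_all
    \<comment> \<open>\<open>A\<close> beats \<open>C\<close>, whose trace on \<open>Q\<close> is
      empty.\<close>
    moreover have "\<not> (\<forall>N \<in> {A, B, C}. \<not> Q \<inter> C \<subset> Q \<inter> N)"
      using QC QAB(1) by (simp add: psubset_eq)
    ultimately have "{M \<in> maxsets K. \<forall>N \<in> maxsets K. \<not> Q \<inter> M \<subset> Q \<inter> N} = \<M>"
      unfolding K AB(1) by blast
    with \<open>Q \<subseteq> K\<close> show ?thesis by blast
  qed
qed

theorem theorem5:
  fixes K :: "'a form set" and R :: "'a form"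
  assumes "finite K"
    and "\<forall>F\<in>K. consistent F"
    and "card (maxsets K) < 4"
    and "consistent R"
    and "or_of_maxsets K R"
  shows "obtainable K R"
proof -
  obtain \<M> where \<M>: "\<M> \<subseteq> maxsets K" and R: "equivalent R (Disj (Conj ` \<M>))"
    using assms(5) by (auto simp: or_of_maxsets_def)
  \<comment> \<open>The empty disjunction is false under every valuation, whereas \<open>R\<close>
    is consistent.\<close>
  have "\<M> \<noteq> {}"
    using R assms(4) by (auto simp: equivalent_def consistent_def holds_Disj)
  then obtain Q where "Q \<subseteq> K"
    and Q: "{M \<in> maxsets K. \<forall>N \<in> maxsets K. \<not> Q \<inter> M \<subset> Q \<inter> N} = \<M>"
    using ex_separating_subset[OF assms(1,3) \<M>] by blast
  then obtain P where "priority_ordering K P" "minimal_maxsets K P = \<M>"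
    using ex_priority_ordering_minimal_maxsets[of Q K] by auto
  with R show ?thesis
    by (auto simp: obtainable_def merge_def)
qed

end
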